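(* If $k\ge 3$ and $k\ne 4$, then Staller has a winning strategy in the S-game of the Maker-Breaker total domination game played on $P_3\,\square\, C_k$ (Cartesian product of the path on $3$ vertices and the cycle on $k$ vertices).
   Context: All graphs are finite and simple. The Maker-Breaker total domination game on a graph $G$ is played by Dominator and Staller, who alternately select a vertex of $G$ not selected before. Dominator wins if at some point the set of vertices he has selected is a total dominating set of $G$ (every vertex has a neighbour in it); otherwise Staller wins, equivalently if she selects all vertices of the open neighbourhood of some vertex. The S-game is the game in which Staller moves first. *)

theory Defs
  imports "Graph_Theory.Pair_Digraph"
begin

text \<open>
  Finite simple graphs are the library's \<^locale>\<open>pair_graph\<close>s: finite, loopless, symmetric
  digraphs whose arcs are pairs of vertices, so that an edge \<open>uv\<close> is the pair of arcs
  \<open>(u, v)\<close> and \<open>(v, u)\<close>.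
\<close>

definition path_graph :: "nat \<Rightarrow> nat pair_pre_digraph" where
  "path_graph n =
    \<lparr> pverts = {..<n},
      parcs = {(i, j). i < n \<and> j < n \<and> (j = Suc i \<or> i = Suc j)} \<rparr>"

text \<open>For \<open>k = 1\<close> the following has a loop and for \<open>k = 2\<close> it is a single edge; it is the
  cycle on \<open>k\<close> vertices for \<open>k \<ge> 3\<close>.\<close>

definition cycle_graph :: "nat \<Rightarrow> nat pair_pre_digraph" where
  "cycle_graph k =
    \<lparr> pverts = {..<k},
      parcs = {(i, j). i < k \<and> j < k \<and> (j = Suc i mod k \<or> i = Suc j mod k)} \<rparr>"

definition cartesian_product ::
    "'a pair_pre_digraph \<Rightarrow> 'b pair_pre_digraph \<Rightarrow> ('a \<times> 'b) pair_pre_digraph"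
    (infixr "\<box>" 70) where
  "G \<box> H =
    \<lparr> pverts = pverts G \<times> pverts H,
      parcs = {((a, b), (a', b')).
        a = a' \<and> a \<in> pverts G \<and> (b, b') \<in> parcs H \<or>
        (a, a') \<in> parcs G \<and> b = b' \<and> b \<in> pverts H} \<rparr>"

lemma pair_graph_path_graph: "pair_graph (path_graph n)"
proof -
  have "finite {(i, j). i < n \<and> j < n \<and> (j = Suc i \<or> i = Suc j)}"
    by (rule finite_subset[of _ "{..<n} \<times> {..<n}"]) auto
  then show ?thesis
    unfolding path_graph_def
    by unfold_locales (auto simp: arcs_ends_def arc_to_ends_def sym_def symmetric_def)
qed

lemma pair_graph_cycle_graph:
  assumes "k \<ge> 3"
  shows "pair_graph (cycle_graph k)"
proof -
  have "finite {(i, j). i < k \<and> j < k \<and> (j = Suc i mod k \<or> i = Suc j mod k)}"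
    by (rule finite_subset[of _ "{..<k} \<times> {..<k}"]) auto
  moreover have "Suc i mod k \<noteq> i" "i \<noteq> Suc i mod k" if "i < k" for i
    using assms that by (cases "Suc i = k"; auto)+
  ultimately show ?thesis
    unfolding cycle_graph_def
    by unfold_locales (auto simp: arcs_ends_def arc_to_ends_def sym_def symmetric_def)
qed

lemma pair_graph_cartesian_product:
  assumes "pair_graph G" "pair_graph H"
  shows "pair_graph (G \<box> H)"
proof -
  interpret G: pair_graph G by fact
  interpret H: pair_graph H by fact
  have "parcs (G \<box> H) \<subseteq> (pverts G \<times> pverts H) \<times> (pverts G \<times> pverts H)"
    by (auto simp: cartesian_product_def dest: G.wellformed' H.wellformed')
  moreover have "finite ((pverts G \<times> pverts H) \<times> (pverts G \<times> pverts H))"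
    by simp
  ultimately have "finite (parcs (G \<box> H))"
    by (rule finite_subset)
  moreover have "sym (parcs (G \<box> H))"
    by (auto simp: cartesian_product_def sym_def intro: G.arcs_symmetric H.arcs_symmetric)
  ultimately show ?thesis
    by unfold_locales
      (auto simp: cartesian_product_def arcs_ends_def arc_to_ends_def symmetric_def
        dest: G.wellformed' H.wellformed' G.no_loops' H.no_loops'
          intro: G.arcs_symmetric H.arcs_symmetric)
qed


definition total_dominating_set :: "'a pair_pre_digraph \<Rightarrow> 'a set \<Rightarrow> bool" where
  "total_dominating_set G S \<longleftrightarrow>
    S \<subseteq> pverts G \<and> (\<forall>v \<in> pverts G. \<exists>u \<in> S. (v, u) \<in> parcs G)"

datatype player = Dominator | Staller

fun opponent :: "player \<Rightarrow> player" where
  "opponent Dominator = Staller"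
| "opponent Staller = Dominator"

text \<open>
  A history is the list of vertices selected so far, earliest first. The parameter \<open>fst_pl\<close> is
  the player who moves first (\<^const>\<open>Staller\<close> in the S-game), so whose turn it is, and who
  selected which vertex, is determined by the parity of the position in the history.
\<close>

definition turn :: "player \<Rightarrow> nat \<Rightarrow> player" where
  "turn fst_pl n = (if even n then fst_pl else opponent fst_pl)"

definition history :: "'a pair_pre_digraph \<Rightarrow> 'a list \<Rightarrow> bool" where
  "history G h \<longleftrightarrow> distinct h \<and> set h \<subseteq> pverts G"

definition selected :: "player \<Rightarrow> player \<Rightarrow> 'a list \<Rightarrow> 'a set" where
  "selected fst_pl P h = {h ! i | i. i < length h \<and> turn fst_pl i = P}"

text \<open>
  Plays go on until all vertices are selected. Continuing after Dominator has obtained a total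
  dominating set is harmless, because the winner is determined by what has happened
  at some point of the play.
\<close>

definition complete_play :: "'a pair_pre_digraph \<Rightarrow> 'a list \<Rightarrow> bool" where
  "complete_play G p \<longleftrightarrow> history G p \<and> set p = pverts G"

definition dominator_wins_play :: "player \<Rightarrow> 'a pair_pre_digraph \<Rightarrow> 'a list \<Rightarrow> bool" where
  "dominator_wins_play fst_pl G p \<longleftrightarrow>
    (\<exists>n \<le> length p. total_dominating_set G (selected fst_pl Dominator (take n p)))"

fun wins_play :: "player \<Rightarrow> 'a pair_pre_digraph \<Rightarrow> player \<Rightarrow> 'a list \<Rightarrow> bool" where
  "wins_play fst_pl G Dominator p \<longleftrightarrow> dominator_wins_play fst_pl G p"
| "wins_play fst_pl G Staller p \<longleftrightarrow> \<not> dominator_wins_play fst_pl G p"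

text \<open>A strategy maps the history to the next vertex; only its values at histories where it is
  its owner's turn matter.\<close>

type_synonym 'a strategy = "'a list \<Rightarrow> 'a"

definition follows :: "player \<Rightarrow> player \<Rightarrow> 'a strategy \<Rightarrow> 'a list \<Rightarrow> bool" where
  "follows fst_pl P \<sigma> h \<longleftrightarrow>
    (\<forall>i < length h. turn fst_pl i = P \<longrightarrow> h ! i = \<sigma> (take i h))"

text \<open>Legality is needed in \<open>winning_strategy\<close> below: a strategy prescribing an illegal move
  could have no complete plays following it at all.\<close>

definition legal_strategy ::
    "player \<Rightarrow> 'a pair_pre_digraph \<Rightarrow> player \<Rightarrow> 'a strategy \<Rightarrow> bool" where
  "legal_strategy fst_pl G P \<sigma> \<longleftrightarrow>
    (\<forall>h. history G h \<and> follows fst_pl P \<sigma> h \<and> set h \<noteq> pverts G \<and> turn fst_pl (length h) = P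
      \<longrightarrow> \<sigma> h \<in> pverts G - set h)"

definition winning_strategy ::
    "player \<Rightarrow> 'a pair_pre_digraph \<Rightarrow> player \<Rightarrow> 'a strategy \<Rightarrow> bool" where
  "winning_strategy fst_pl G P \<sigma> \<longleftrightarrow>
    legal_strategy fst_pl G P \<sigma> \<and>
    (\<forall>p. complete_play G p \<and> follows fst_pl P \<sigma> p \<longrightarrow> wins_play fst_pl G P p)"

abbreviation s_game_winning_strategy ::
    "'a pair_pre_digraph \<Rightarrow> player \<Rightarrow> 'a strategy \<Rightarrow> bool" where
  "s_game_winning_strategy \<equiv> winning_strategy Staller"

end

(* Staller opens with a vertex (1, 0) of the middle row. For a sign s = 1, -1 and an outer row r
   with opposite outer row 2 - r she can then take (r, s), which forces Dominator to take (r, -s)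
   because of N(r, 0), and next (1, 2s), which leaves the two threats (2 - r, s) in N(1, s) and
   (r, 3s) in N(r, 2s). No reply of Dominator to the opening blocks all four of these plans. The
   vertices of one plan that lie in a common row have columns differing by 2 or 4, and k divides
   neither when k >= 3 and k is not 4. *)

theory Submission
  imports Defs
begin

section \<open>Winning positions\<close>

text \<open>The player argument is the one to move. On a full board only \<open>claimed\<close> applies, because of
  the premise \<open>S \<union> D \<noteq> pverts G\<close>.\<close>

inductive staller_wins :: "'a pair_pre_digraph \<Rightarrow> player \<Rightarrow> 'a set \<Rightarrow> 'a set \<Rightarrow> bool"
  for G where
  claimed: "v \<in> pverts G \<Longrightarrow> {u. (v, u) \<in> parcs G} \<subseteq> S \<Longrightarrow> staller_wins G P S D"
| staller: "v \<in> pverts G - (S \<union> D) \<Longrightarrow> staller_wins G Dominator (insert v S) D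
    \<Longrightarrow> staller_wins G Staller S D"
| dominator: "S \<union> D \<noteq> pverts G
    \<Longrightarrow> (\<And>v. v \<in> pverts G - (S \<union> D) \<Longrightarrow> staller_wins G Staller S (insert v D))
    \<Longrightarrow> staller_wins G Dominator S D"

section \<open>Selected vertices along a history, and the passage from positions to
  strategies\<close>

lemma selected_snoc:
  "selected f P (h @ [v]) =
    (if turn f (length h) = P then insert v (selected f P h) else selected f P h)"
proof -
  \<comment> \<open>As an image, the set splits when its index set does.\<close>
  have image: "selected f P h = (!) h ` {i. i < length h \<and> turn f i = P}" for h
    by (auto simp: selected_def)
  have "{i. i < length (h @ [v]) \<and> turn f i = P} =
      {i. i < length h \<and> turn f i = P} \<union> (if turn f (length h) = P then {length h} else {})"
    by (auto simp: less_Suc_eq)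
  moreover have "(!) (h @ [v]) ` {i. i < length h \<and> turn f i = P} =
      (!) h ` {i. i < length h \<and> turn f i = P}"
    by (rule image_cong) (auto simp: nth_append)
  ultimately show ?thesis
    unfolding image by (simp only: image_Un) simp
qed

lemma set_eq_selected: "set h = selected f Staller h \<union> selected f Dominator h"
proof -
  have "P = Staller \<or> P = Dominator" for P
    by (cases P) auto
  then show ?thesis
    unfolding selected_def set_conv_nth by auto
qed

lemma selected_disjoint:
  assumes "distinct h" "P \<noteq> Q"
  shows "selected f P h \<inter> selected f Q h = {}"
  using assms unfolding selected_def by (auto simp: nth_eq_iff_index_eq)

lemma selected_take_subset: "selected f P (take n h) \<subseteq> selected f P h"
  unfolding selected_def by auto

lemma turn_Suc: "turn f (Suc n) = opponent (turn f n)"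
  by (cases f) (auto simp: turn_def)

lemma follows_snoc:
  "follows f P \<sigma> (h @ [v]) \<longleftrightarrow> follows f P \<sigma> h \<and> (turn f (length h) = P \<longrightarrow> v = \<sigma> h)"
  unfolding follows_def by (auto simp: nth_append less_Suc_eq)

text \<open>Staller's strategy picks a free vertex that keeps the position winning whenever it is
  winning. Being in \<open>staller_wins\<close> is then an invariant of every play that follows it,
  and on the full board this leaves only a claimed neighbourhood.\<close>

theorem winning_strategy_if_staller_wins:
  fixes G :: "'a pair_pre_digraph"
  assumes start: "staller_wins G f {} {}"
  shows "\<exists>\<sigma>. winning_strategy f G Staller \<sigma>"
proof -
  define S :: "'a list \<Rightarrow> 'a set" where "S = selected f Staller"
  define D :: "'a list \<Rightarrow> 'a set" where "D = selected f Dominator"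
  \<comment> \<open>In a position not known to be won the implication is void and any free vertex is
    \<open>good\<close>, so \<open>\<sigma>\<close> is legal at every incomplete history.\<close>
  define good where "good h v \<longleftrightarrow> v \<in> pverts G - set h \<and>
    (staller_wins G Staller (S h) (D h) \<longrightarrow> staller_wins G Dominator (insert v (S h)) (D h))"
    for h v
  define \<sigma> where "\<sigma> h = (SOME v. good h v)" for h
  have set_h: "set h = S h \<union> D h" for h
    unfolding S_def D_def by (rule set_eq_selected)
  have good: "good h (\<sigma> h)" if h: "history G h" "set h \<noteq> pverts G" for h
  proof -
    obtain w where w: "w \<in> pverts G - set h"
      using h unfolding history_def by blast
    have "\<exists>v. good h v"
    proof (cases "staller_wins G Staller (S h) (D h)")
      case True
      then show ?thesis
      proof cases
        \<comment> \<open>A claimed neighbourhood stays claimed, so the arbitrary free vertex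
          \<open>w\<close> will do.\<close>
        case (claimed v)
        then have "staller_wins G Dominator (insert w (S h)) (D h)"
          by (intro staller_wins.claimed[of v]) auto
        with w show ?thesis
          unfolding good_def by blast
      qed (auto simp: good_def set_h)
    qed (use w in \<open>auto simp: good_def\<close>)
    then show ?thesis
      unfolding \<sigma>_def by (rule someI_ex)
  qed
  have inv: "staller_wins G (turn f (length h)) (S h) (D h)"
    if "history G h" "follows f Staller \<sigma> h" for h
    using that
  proof (induction h rule: rev_induct)
    case Nil
    then show ?case
      using start by (simp add: S_def D_def selected_def turn_def)
  next
    case (snoc v h)
    have v: "v \<in> pverts G - set h" and h: "history G h" "set h \<noteq> pverts G"
      using snoc.prems by (auto simp: history_def)
    have IH: "staller_wins G (turn f (length h)) (S h) (D h)"
      using snoc h by (simp add: follows_snoc)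
    show ?case
    proof (cases "turn f (length h)")
      case Staller
      then have "v = \<sigma> h"
        using snoc.prems by (simp add: follows_snoc)
      with good[OF h] IH Staller show ?thesis
        by (simp add: good_def S_def D_def selected_snoc turn_Suc)
    next
      case Dominator
      from IH have "staller_wins G Staller (S h) (insert v (D h))"
        unfolding Dominator
        by cases (use v in \<open>auto simp: set_h intro: staller_wins.claimed\<close>)
      with Dominator show ?thesis
        by (simp add: S_def D_def selected_snoc turn_Suc)
    qed
  qed
  have "winning_strategy f G Staller \<sigma>"
    unfolding winning_strategy_def legal_strategy_def
  proof (intro conjI allI impI; elim conjE)
    fix h
    assume "history G h" "set h \<noteq> pverts G"
    then show "\<sigma> h \<in> pverts G - set h"
      using good unfolding good_def by blast
  next
    fix p
    assume p: "complete_play G p" "follows f Staller \<sigma> p"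
    then have full: "S p \<union> D p = pverts G" and dist: "distinct p"
      unfolding complete_play_def history_def set_h by auto
    have "staller_wins G (turn f (length p)) (S p) (D p)"
      using p inv unfolding complete_play_def by blast
    then obtain v where v: "v \<in> pverts G" "{u. (v, u) \<in> parcs G} \<subseteq> S p"
      by cases (use full in auto)
    have "S p \<inter> D p = {}"
      unfolding S_def D_def by (rule selected_disjoint[OF dist]) simp
    \<comment> \<open>All neighbours of \<open>v\<close> end up with Staller, and Dominator's
      earlier sets lie in his final one, so \<open>v\<close> is never dominated.\<close>
    with v have "\<not> total_dominating_set G (selected f Dominator (take n p))" for n
      using selected_take_subset[of f Dominator n p]
      unfolding total_dominating_set_def D_def by blast
    then show "wins_play f G Staller p"
      by (simp add: dominator_wins_play_def)
  qed
  then show ?thesis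
    by blast
qed

section \<open>Threats and double threats\<close>

lemma staller_wins_completing:
  assumes "a \<in> pverts G - (S \<union> D)" "w \<in> pverts G" "{u. (w, u) \<in> parcs G} \<subseteq> insert a S"
  shows "staller_wins G Staller S D"
  using assms by (blast intro: staller_wins.staller staller_wins.claimed)

text \<open>After \<open>v\<close>, any reply other than \<open>a\<close> lets Staller complete the
  neighbourhood of \<open>w\<close> by taking \<open>a\<close>; hence only the reply
  \<open>a\<close> has to be examined.\<close>

lemma staller_wins_forcing:
  assumes "v \<in> pverts G - (S \<union> D)" "a \<in> pverts G - (S \<union> D)" "a \<noteq> v"
    and "w \<in> pverts G" "{u. (w, u) \<in> parcs G} \<subseteq> insert a (insert v S)"
    and "staller_wins G Staller (insert v S) (insert a D)"
  shows "staller_wins G Staller S D"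
proof (rule staller_wins.staller[OF assms(1)], rule staller_wins.dominator)
  show "insert v S \<union> D \<noteq> pverts G"
    using assms by auto
  fix d
  assume d: "d \<in> pverts G - (insert v S \<union> D)"
  show "staller_wins G Staller (insert v S) (insert d D)"
  proof (cases "d = a")
    case False
    with assms(2,3) have "a \<in> pverts G - (insert v S \<union> insert d D)"
      by blast
    then show ?thesis
      using assms(4,5) by (rule staller_wins_completing)
  qed (use assms in simp)
qed

text \<open>Dominator is forced to \<open>a\<close> by the threat at \<open>w\<close>, and
  \<open>b\<close> then completes the neighbourhood of \<open>w'\<close>.\<close>

lemma staller_wins_two_threats:
  assumes "v \<in> pverts G - (S \<union> D)" "a \<in> pverts G - (S \<union> D)" "b \<in> pverts G - (S \<union> D)"
    and "distinct [v, a, b]"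
    and "w \<in> pverts G" "{u. (w, u) \<in> parcs G} \<subseteq> insert a (insert v S)"
    and "w' \<in> pverts G" "{u. (w', u) \<in> parcs G} \<subseteq> insert b (insert v S)"
  shows "staller_wins G Staller S D"
proof (rule staller_wins_forcing[OF assms(1,2) _ assms(5,6)])
  show "a \<noteq> v"
    using assms(4) by auto
  have "b \<in> pverts G - (insert v S \<union> insert a D)"
    using assms(3,4) by auto
  then show "staller_wins G Staller (insert v S) (insert a D)"
    using assms(7,8) by (rule staller_wins_completing)
qed

section \<open>The product of a path and a cycle\<close>

text \<open>Integer arguments allow negative columns, so a plan and its mirror image differ only in
  a sign.\<close>

definition col :: "nat \<Rightarrow> int \<Rightarrow> nat" where
  "col k i = nat (i mod int k)"

lemma col_less: "k > 0 \<Longrightarrow> col k i < k"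
  by (simp add: col_def nat_less_iff)

lemma col_eq_iff: "k > 0 \<Longrightarrow> col k i = col k j \<longleftrightarrow> int k dvd i - j"
  by (simp add: col_def mod_eq_dvd_iff nat_eq_iff)

lemma Suc_col_mod: "k > 0 \<Longrightarrow> Suc (col k i) mod k = col k (i + 1)"
proof -
  assume "k > 0"
  then have "int (Suc (col k i) mod k) = int (col k (i + 1))"
    by (simp add: col_def zmod_int mod_simps add.commute)
  then show ?thesis
    by (simp only: of_nat_eq_iff)
qed

text \<open>The arcs of \<open>cycle_graph\<close> are given by successors in both directions;
  inverting the successor yields the left neighbour.\<close>

lemma Suc_mod_eq_colD:
  assumes "j < k" "Suc j mod k = col k i"
  shows "j = col k (i - 1)"
proof -
  have j: "col k (int j) = j"
    using assms by (simp add: col_def)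
  with assms have "col k (int j + 1) = col k i"
    using Suc_col_mod[of k "int j"] by simp
  then have "col k (int j) = col k (i - 1)"
    using assms by (simp add: col_eq_iff algebra_simps)
  with j show ?thesis
    by simp
qed

lemma cycle_nbhd_col:
  assumes "(col k i, j) \<in> parcs (cycle_graph k)"
  shows "j = col k (i - 1) \<or> j = col k (i + 1)"
  using assms Suc_col_mod[of k i] Suc_mod_eq_colD[of j k i] by (auto simp: cycle_graph_def)

text \<open>An inclusion is enough, since \<open>claimed\<close> asks for an inclusion too.\<close>

lemma nbhd_outer_row:
  assumes "r = 0 \<or> r = 2"
  shows "{u. ((r, col k i), u) \<in> parcs (path_graph 3 \<box> cycle_graph k)}
    \<subseteq> {(r, col k (i - 1)), (r, col k (i + 1)), (1, col k i)}"
  using assms by (auto simp: cartesian_product_def path_graph_def dest: cycle_nbhd_col)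

lemma nbhd_middle_row:
  "{u. ((1, col k i), u) \<in> parcs (path_graph 3 \<box> cycle_graph k)}
    \<subseteq> {(1, col k (i - 1)), (1, col k (i + 1)), (0, col k i), (2, col k i)}"
  by (auto simp: cartesian_product_def path_graph_def less_Suc_eq numeral_3_eq_3
      dest: cycle_nbhd_col)

lemma mem_pverts_col:
  "k > 0 \<Longrightarrow> (r, col k i) \<in> pverts (path_graph 3 \<box> cycle_graph k) \<longleftrightarrow> r < 3"
  by (simp add: cartesian_product_def path_graph_def cycle_graph_def col_less)

text \<open>Such an \<open>i\<close> divides 4, so \<open>k\<close> would divide 4, which the bounds
  on \<open>k\<close> exclude.\<close>

lemma not_dvd_2_4:
  assumes "k \<ge> 3" "k \<noteq> 4" "\<bar>i\<bar> = 2 \<or> \<bar>i\<bar> = 4"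
  shows "\<not> int k dvd i"
proof
  assume "int k dvd i"
  then have "int k dvd \<bar>i\<bar>"
    by simp
  also have "\<bar>i\<bar> dvd 4"
    using assms(3) by (elim disjE; simp only:; simp)
  finally have "k dvd 4"
    using int_dvd_int_iff[of k 4] by simp
  moreover from this have "k \<le> 4"
    by (simp add: dvd_imp_le)
  ultimately show False
    using assms(1,2) by (cases "k = 3") auto
qed

text \<open>Here \<open>d\<close> is Dominator's reply to the opening, and the excluded set lists
  every vertex that the plan needs free: Staller's two moves, the forced reply and the two final
  threats.\<close>

lemma staller_wins_plan:
  fixes s :: int and r :: nat
  assumes k: "k \<ge> 3" "k \<noteq> 4" and s: "s = 1 \<or> s = - 1" and r: "r = 0 \<or> r = 2"
    and d: "d \<notin> {(r, col k s), (r, col k (- s)), (r, col k (3 * s)), (2 - r, col k s),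
      (1, col k (2 * s))}"
  shows "staller_wins (path_graph 3 \<box> cycle_graph k) Staller {(1, col k 0)} {d}"
proof -
  let ?G = "path_graph 3 \<box> cycle_graph k"
  have k0: "k > 0"
    using k by simp
  have ne: "col k i \<noteq> col k j" if "\<bar>i - j\<bar> = 2 \<or> \<bar>i - j\<bar> = 4" for i j
    using that k k0 not_dvd_2_4[of k "i - j"] by (simp add: col_eq_iff)
  note mem = mem_pverts_col[OF k0]
  show ?thesis
  proof (rule staller_wins_forcing)
    show "(r, col k s) \<in> pverts ?G - ({(1, col k 0)} \<union> {d})"
      "(r, col k (- s)) \<in> pverts ?G - ({(1, col k 0)} \<union> {d})"
      using r d by (auto simp: mem)
    show "(r, col k (- s)) \<noteq> (r, col k s)"
      using s ne[of "- s" s] by auto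
    show "(r, col k 0) \<in> pverts ?G"
      using r by (auto simp: mem)
    show "{u. ((r, col k 0), u) \<in> parcs ?G}
        \<subseteq> {(r, col k (- s)), (r, col k s), (1, col k 0)}"
      by (rule order_trans[OF nbhd_outer_row[OF r]]) (use s in auto)
    show "staller_wins ?G Staller {(r, col k s), (1, col k 0)} {(r, col k (- s)), d}"
    proof (rule staller_wins_two_threats)
      have "col k (2 * s) \<noteq> col k 0"
        using s ne[of "2 * s" 0] by auto
      then show "(1, col k (2 * s))
          \<in> pverts ?G - ({(r, col k s), (1, col k 0)} \<union> {(r, col k (- s)), d})"
        using r d by (auto simp: mem)
      show "(2 - r, col k s)
          \<in> pverts ?G - ({(r, col k s), (1, col k 0)} \<union> {(r, col k (- s)), d})"
        using r d by (auto simp: mem)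
      \<comment> \<open>For \<open>k = 4\<close> the columns \<open>3 * s\<close> and
        \<open>- s\<close> would coincide, and the second threat would be at Dominator's forced
        reply.\<close>
      have "col k (3 * s) \<noteq> col k s" "col k (3 * s) \<noteq> col k (- s)"
        using s ne[of "3 * s" s] ne[of "3 * s" "- s"] by auto
      then show "(r, col k (3 * s))
          \<in> pverts ?G - ({(r, col k s), (1, col k 0)} \<union> {(r, col k (- s)), d})"
        using r d by (auto simp: mem)
      \<comment> \<open>The three vertices lie in three different rows.\<close>
      show "distinct [(1, col k (2 * s)), (2 - r, col k s), (r, col k (3 * s))]"
        using r by auto
      show "(1, col k s) \<in> pverts ?G" "(r, col k (2 * s)) \<in> pverts ?G"
        using r by (auto simp: mem)
      show "{u. ((1, col k s), u) \<in> parcs ?G}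
          \<subseteq> {(2 - r, col k s), (1, col k (2 * s)), (r, col k s), (1, col k 0)}"
        by (rule order_trans[OF nbhd_middle_row]) (use s r in auto)
      show "{u. ((r, col k (2 * s)), u) \<in> parcs ?G}
          \<subseteq> {(r, col k (3 * s)), (1, col k (2 * s)), (r, col k s), (1, col k 0)}"
        by (rule order_trans[OF nbhd_outer_row[OF r]]) (use s in auto)
    qed
  qed
qed

theorem theorem4p4:
  fixes k :: nat
  assumes "k \<ge> 3" and "k \<noteq> 4"
  shows "\<exists>\<sigma>. s_game_winning_strategy (path_graph 3 \<box> cycle_graph k) Staller \<sigma>"
proof (rule winning_strategy_if_staller_wins, rule staller_wins.staller)
  show "(1, col k 0) \<in> pverts (path_graph 3 \<box> cycle_graph k) - ({} \<union> {})"
    using assms by (simp add: mem_pverts_col)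
next
  have k0: "k > 0"
    using assms by simp
  show "staller_wins (path_graph 3 \<box> cycle_graph k) Dominator {(1, col k 0)} {}"
  proof (rule staller_wins.dominator)
    have "(0, col k 0) \<in> pverts (path_graph 3 \<box> cycle_graph k)"
      using k0 by (simp add: mem_pverts_col)
    then show "{(1, col k 0)} \<union> {} \<noteq> pverts (path_graph 3 \<box> cycle_graph k)"
      by auto
    fix d
    assume "d \<in> pverts (path_graph 3 \<box> cycle_graph k) - ({(1, col k 0)} \<union> {})"
    then obtain a c where d: "d = (a, c)" "a < 3"
      by (auto simp: cartesian_product_def path_graph_def)
    have ne: "col k 1 \<noteq> col k (- 1)" "col k 2 \<noteq> col k (- 2)"
      using assms k0 by (auto simp: col_eq_iff not_dvd_2_4)
    \<comment> \<open>Row \<open>r\<close> avoids \<open>d\<close>. So \<open>d\<close> can meet the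
      plan only at \<open>(2 - r, col k s)\<close> or, if \<open>a = 1\<close>, at
      \<open>(1, col k (2 * s))\<close>.\<close>
    define r :: nat where "r = (if a = 0 then 2 else 0)"
    \<comment> \<open>By \<open>ne\<close> the two signs put the vertex at risk in different
      columns, so \<open>d\<close> spoils at most one of them.\<close>
    obtain s :: int where s: "s = 1 \<or> s = - 1"
      and c: "c \<noteq> (if a = 1 then col k (2 * s) else col k s)"
    proof (cases "c = (if a = 1 then col k 2 else col k 1)")
      case True
      with ne show ?thesis
        by (intro that[of "- 1"]) auto
    next
      case False
      then show ?thesis
        by (intro that[of 1]) auto
    qed
    have "staller_wins (path_graph 3 \<box> cycle_graph k) Staller {(1, col k 0)} {d}"
    proof (rule staller_wins_plan[OF assms s])
      show "r = 0 \<or> r = 2"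
        by (simp add: r_def)
      show "d \<notin> {(r, col k s), (r, col k (- s)), (r, col k (3 * s)), (2 - r, col k s),
          (1, col k (2 * s))}"
        using d c by (auto simp: r_def)
    qed
    then show "staller_wins (path_graph 3 \<box> cycle_graph k) Staller {(1, col k 0)} (insert d {})" .
  qed
qed

end
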